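(* Let $\varepsilon \in \mathbb{R}\cup\{\infty\}$, and let $N(\varepsilon)$ be the set of pairs $(I^-,I^+)$ of those branch-and-bound nodes which got pruned by integrality or pruned by bound during the execution of the branch-and-bound algorithm (described in the context) applied to $\mathrm{BOSRFLP}(\varepsilon)$. Then for all $\varepsilon' \le \varepsilon$, $$F(\varepsilon') \subseteq \bigcup_{(I^-,I^+)\in N(\varepsilon)} F(\varepsilon',I^-,I^+).$$
   Context: **Data.** Let $I=\{1,\dots,n\}$ be a set of facilities with lengths $\ell_i\in\mathbb{R}_{>0}$, $i \in I$, and for $q\in\{1,2\}$ let $c^q_{ij}\in\mathbb{R}_{\ge 0}$, $i,j\in I$, be symmetric weights. Let $I^2=\{ij : i,j\in I,\ i<j\}$ (pairs written as two-letter indices), so $|I^2|=\binom n2$. For $q\in\{1,2\}$ let $K_q=\big(\sum_{i<j}\tfrac{c^q_{ij}}{2}\big)\big(\sum_{k\in I}\ell_k\big)$ and let $C_q=\tfrac12(\widetilde C_q+\widetilde C_q^T)\in\mathbb{R}^{\binom n2\times\binom n2}$, where for $ij,kh\in I^2$ the entry $(\widetilde C_q)_{ij,kh}$ equals $-\tfrac{c^q_{jh}}{2}\ell_i$ if $i<j<h$ and $k=i$; equals $\tfrac{c^q_{ih}}{2}\ell_j$ if $i<j<h$ and $k=j$; equals $-\tfrac{c^q_{ik}}{2}\ell_j$ if $i<k<j$ and $h=j$; and equals $0$ otherwise. $\langle\cdot,\cdot\rangle$ is the Frobenius inner product and $e$ is the all-ones vector. **Variables and index convention.** $x\in\mathbb{R}^{\binom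 n2}$ and $X\in\mathbb{R}^{\binom n2\times\binom n2}$ (symmetric) are indexed by $I^2$. For $i\ne j$, $k\neq h$ not necessarily ordered, set $X_{ij,kh}=\tau(i,j)\tau(k,h)X_{\min\{i,j\}\max\{i,j\},\min\{k,h\}\max\{k,h\}}$, where $\tau(i,j)=1$ if $i<j$ and $\tau(i,j)=-1$ otherwise. **Constraints.** (a) $K_2+\langle C_2,X\rangle\le\varepsilon$ (void if $\varepsilon=\infty$); (b) $\sum_{k\in I,\, i\ne k\ne j}\big(X_{ij,jk}-X_{ij,ik}-X_{ik,jk}\big)=-(n-2)$ for all $i,j\in I$, $i<j$; (c) $\mathrm{diag}(X)=e$; (d) $\begin{pmatrix}1 & x^T \\ x & X\end{pmatrix}\succeq0$; (e) $x_{ij}\in\{-1,1\}$ for all $ij\in I^2$; (f) $x_{ij}=-1$ for all $ij\in I^-$ and $x_{ij}=1$ for all $ij\in I^+$. **Problems and feasible regions.** $\mathrm{BOSRFLP}(\varepsilon)$ is the problem of minimizing $K_1+\langle C_1,X\rangle$ subject to (a)–(e); its feasible region is denoted $F(\varepsilon)$. For $I^-,I^+\subseteq I^2$, $\mathrm{SDP}(\varepsilon,I^-,I^+)$ is the problem of minimizing $K_1+\langle C_1,X\rangle$ subject to (a)–(d) and (f); its feasible region is denoted $F(\varepsilon,I^-,I^+)$. **Branch-and-bound algorithm applied to $\mathrm{BOSRFLP}(\varepsilon)$.** A node is a triple $(z,I^-,I^+)$. Initialize the incumbent value $z^{UB}=\infty$ and the queue $\mathcal Q$ with the single node $(-\infty,\emptyset,\emptyset)$.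 While $\mathcal Q\ne\emptyset$: remove from $\mathcal Q$ a node $(z^*,I^-,I^+)$ with smallest $z^*$. 1. If $z^*\ge z^{UB}$, stop; this node and all nodes remaining in $\mathcal Q$ are *pruned by bound*. 2. Otherwise solve $\mathrm{SDP}(\varepsilon,I^-,I^+)$ to optimality. If it is infeasible, the node is *pruned by infeasibility*; continue with the next node. Otherwise let $z^*$ now be the optimal value and $(x^*,X^* )$ an optimal solution. 3. If $x^*\in\{-1,1\}^{\binom n2}$, the node is *pruned by integrality*: if $z^*<z^{UB}$ the incumbent becomes $(x^*,X^* )$ with $z^{UB}=z^*$; continue with the next node. 4. Otherwise, a heuristic possibly returns a feasible solution of $\mathrm{BOSRFLP}(\varepsilon)$; if its objective value is smaller than $z^{UB}$, it replaces the incumbent. 5. If $z^*\ge z^{UB}$, the node is *pruned by bound*; continue with the next node. 6. Otherwise choose a branching index $ij\in I^2\setminus(I^-\cup I^+)$ (by an arbitrary rule) with $x^*_{ij}\notin\{-1,1\}$, and add the two nodes $(z^*,I^-\cup\{ij\},I^+)$ and $(z^*,I^-,I^+\cup\{ij\})$ to $\mathcal Q$. *)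

theory Defs
  imports Complex_Main "HOL-Library.Extended_Real" "HOL-Library.FuncSet" "HOL-Library.Multiset"
begin

text \<open>
  Facilities are the numbers \<open>1, \<dots>, n\<close>.  The data of an instance are the number \<open>n\<close>, the
  lengths \<open>l i\<close>, and the weights \<open>c q i j\<close> of the two objectives \<open>q = 1, 2\<close>.
  Vectors and matrices indexed by \<open>I2 n\<close> are extensional functions on \<open>I2 n\<close> and on
  \<open>I2 n \<times> I2 n\<close>, so that they are determined by their entries.
\<close>

type_synonym I2_vec = "nat \<times> nat \<Rightarrow> real"
type_synonym I2_mat = "(nat \<times> nat) \<times> (nat \<times> nat) \<Rightarrow> real"
type_synonym solution = "I2_vec \<times> I2_mat"
type_synonym lengths = "nat \<Rightarrow> real"
type_synonym weights = "nat \<Rightarrow> nat \<Rightarrow> nat \<Rightarrow> real"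

definition I2 :: "nat \<Rightarrow> (nat \<times> nat) set" where
  "I2 n = {(i, j). i \<in> {1..n} \<and> j \<in> {1..n} \<and> i < j}"

definition frob :: "nat \<Rightarrow> I2_mat \<Rightarrow> I2_mat \<Rightarrow> real" where
  "frob n A B = (\<Sum>p\<in>I2 n. \<Sum>r\<in>I2 n. A (p, r) * B (p, r))"

definition K_const :: "nat \<Rightarrow> lengths \<Rightarrow> weights \<Rightarrow> nat \<Rightarrow> real" where
  "K_const n l c q = (\<Sum>(i, j)\<in>I2 n. c q i j / 2) * (\<Sum>k\<in>{1..n}. l k)"

fun C_tilde :: "lengths \<Rightarrow> weights \<Rightarrow> nat \<Rightarrow> I2_mat" where
  "C_tilde l c q ((i, j), (k, h)) =
    (if i < j \<and> j < h \<and> k = i then - (c q j h / 2) * l i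
     else if i < j \<and> j < h \<and> k = j then c q i h / 2 * l j
     else if i < k \<and> k < j \<and> h = j then - (c q i k / 2) * l j
     else 0)"

definition C_mat :: "lengths \<Rightarrow> weights \<Rightarrow> nat \<Rightarrow> I2_mat" where
  "C_mat l c q = (\<lambda>(p, r). (C_tilde l c q (p, r) + C_tilde l c q (r, p)) / 2)"

definition objective :: "nat \<Rightarrow> lengths \<Rightarrow> weights \<Rightarrow> nat \<Rightarrow> I2_mat \<Rightarrow> real" where
  "objective n l c q X = K_const n l c q + frob n (C_mat l c q) X"

definition tau :: "nat \<Rightarrow> nat \<Rightarrow> real" where
  "tau i j = (if i < j then 1 else - 1)"

text \<open>Access to the entries of \<open>X\<close> by pairs that need not be ordered.\<close>

definition entry :: "I2_mat \<Rightarrow> nat \<Rightarrow> nat \<Rightarrow> nat \<Rightarrow> nat \<Rightarrow> real" where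
  "entry X i j k h = tau i j * tau k h * X ((min i j, max i j), (min k h, max k h))"

definition psd_on :: "'a set \<Rightarrow> ('a \<Rightarrow> 'a \<Rightarrow> real) \<Rightarrow> bool" where
  "psd_on S M \<longleftrightarrow> (\<forall>a\<in>S. \<forall>b\<in>S. M a b = M b a) \<and>
     (\<forall>v. 0 \<le> (\<Sum>a\<in>S. \<Sum>b\<in>S. v a * M a b * v b))"

text \<open>The block matrix with first row \<open>(1, x\<^sup>T)\<close>, first column \<open>(1, x)\<close> and lower right block
  \<open>X\<close>; the index \<open>None\<close> stands for the additional row and column.\<close>

fun bordered :: "I2_vec \<Rightarrow> I2_mat \<Rightarrow> (nat \<times> nat) option \<Rightarrow> (nat \<times> nat) option \<Rightarrow> real" where
  "bordered x X None None = 1"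
| "bordered x X None (Some r) = x r"
| "bordered x X (Some p) None = x p"
| "bordered x X (Some p) (Some r) = X (p, r)"

text \<open>The constraints shared by both problems.  The bound \<open>\<epsilon>\<close> is an extended real, so the first
  constraint on the second objective is void for \<open>\<epsilon> = \<infinity>\<close>.  Symmetry of \<open>X\<close> is part of
  \<open>psd_on\<close>.\<close>

definition relaxed :: "nat \<Rightarrow> lengths \<Rightarrow> weights \<Rightarrow> ereal \<Rightarrow> solution set" where
  "relaxed n l c \<epsilon> = {(x, X). x \<in> extensional (I2 n) \<and> X \<in> extensional (I2 n \<times> I2 n) \<and>
     ereal (objective n l c 2 X) \<le> \<epsilon> \<and>
     (\<forall>(i, j)\<in>I2 n.
        (\<Sum>k\<in>{1..n} - {i, j}. entry X i j j k - entry X i j i k - entry X i k j k)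
          = - (real n - 2)) \<and>
     (\<forall>p\<in>I2 n. X (p, p) = 1) \<and>
     psd_on (insert None (Some ` I2 n)) (bordered x X)}"

definition is_integral :: "nat \<Rightarrow> I2_vec \<Rightarrow> bool" where
  "is_integral n x \<longleftrightarrow> (\<forall>p\<in>I2 n. x p \<in> {- 1, 1})"

definition feasible :: "nat \<Rightarrow> lengths \<Rightarrow> weights \<Rightarrow> ereal \<Rightarrow> solution set" where
  "feasible n l c \<epsilon> = {(x, X) \<in> relaxed n l c \<epsilon>. is_integral n x}"

definition feasible_sdp ::
  "nat \<Rightarrow> lengths \<Rightarrow> weights \<Rightarrow> ereal \<Rightarrow> (nat \<times> nat) set \<Rightarrow> (nat \<times> nat) set \<Rightarrow> solution set" where
  "feasible_sdp n l c \<epsilon> Jm Jp = {(x, X) \<in> relaxed n l c \<epsilon>.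
     (\<forall>p\<in>Jm. x p = - 1) \<and> (\<forall>p\<in>Jp. x p = 1)}"

definition optimal_sdp ::
  "nat \<Rightarrow> lengths \<Rightarrow> weights \<Rightarrow> ereal \<Rightarrow> (nat \<times> nat) set \<Rightarrow> (nat \<times> nat) set \<Rightarrow> solution \<Rightarrow> bool" where
  "optimal_sdp n l c \<epsilon> Jm Jp = (\<lambda>(x, X). (x, X) \<in> feasible_sdp n l c \<epsilon> Jm Jp \<and>
     (\<forall>(y, Y)\<in>feasible_sdp n l c \<epsilon> Jm Jp. objective n l c 1 X \<le> objective n l c 1 Y))"

text \<open>
  Branch and bound as a transition system.  One step is one pass through the loop; every free
  choice (node among those of least bound, optimal solution, result of the heuristic, branching
  index) is nondeterministic.  The incumbent value is determined by the incumbent; it is \<open>\<infinity>\<close> as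
  long as there is none.
\<close>

type_synonym node = "ereal \<times> (nat \<times> nat) set \<times> (nat \<times> nat) set"

record bb_state =
  queue :: "node multiset"
  incumbent :: "solution option"
  by_integrality :: "((nat \<times> nat) set \<times> (nat \<times> nat) set) set"
  by_bound :: "((nat \<times> nat) set \<times> (nat \<times> nat) set) set"

definition bb_init :: bb_state where
  "bb_init = \<lparr>queue = {#(- \<infinity>, {}, {})#}, incumbent = None,
     by_integrality = {}, by_bound = {}\<rparr>"

fun ub :: "nat \<Rightarrow> lengths \<Rightarrow> weights \<Rightarrow> solution option \<Rightarrow> ereal" where
  "ub n l c None = \<infinity>"
| "ub n l c (Some (x, X)) = ereal (objective n l c 1 X)"

definition improve ::
  "nat \<Rightarrow> lengths \<Rightarrow> weights \<Rightarrow> solution option \<Rightarrow> solution \<Rightarrow> solution option" where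
  "improve n l c inc sol = (if ub n l c (Some sol) < ub n l c inc then Some sol else inc)"

definition heuristic_update ::
  "nat \<Rightarrow> lengths \<Rightarrow> weights \<Rightarrow> ereal \<Rightarrow> solution option \<Rightarrow> solution option \<Rightarrow> bool" where
  "heuristic_update n l c \<epsilon> inc inc' \<longleftrightarrow>
     inc' = inc \<or> (\<exists>sol\<in>feasible n l c \<epsilon>. inc' = improve n l c inc sol)"

definition selected :: "bb_state \<Rightarrow> node \<Rightarrow> bool" where
  "selected s \<nu> \<longleftrightarrow> \<nu> \<in># queue s \<and> (\<forall>\<mu>\<in>#queue s. fst \<nu> \<le> fst \<mu>)"

inductive bb_step ::
  "nat \<Rightarrow> lengths \<Rightarrow> weights \<Rightarrow> ereal \<Rightarrow> bb_state \<Rightarrow> bb_state \<Rightarrow> bool"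
  for n l c \<epsilon> where
  \<comment> \<open>the loop is left: emptying the queue leaves no further step\<close>
  stop:
  "\<lbrakk>selected s (z, Jm, Jp); z \<ge> ub n l c (incumbent s)\<rbrakk> \<Longrightarrow>
   bb_step n l c \<epsilon> s
     (s\<lparr>queue := {#}, by_bound := by_bound s \<union> snd ` set_mset (queue s)\<rparr>)"
| infeasible:
  "\<lbrakk>selected s (z, Jm, Jp); z < ub n l c (incumbent s);
    feasible_sdp n l c \<epsilon> Jm Jp = {}\<rbrakk> \<Longrightarrow>
   bb_step n l c \<epsilon> s (s\<lparr>queue := queue s - {#(z, Jm, Jp)#}\<rparr>)"
| integrality:
  "\<lbrakk>selected s (z, Jm, Jp); z < ub n l c (incumbent s);
    optimal_sdp n l c \<epsilon> Jm Jp (x, X); is_integral n x\<rbrakk> \<Longrightarrow>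
   bb_step n l c \<epsilon> s
     (s\<lparr>queue := queue s - {#(z, Jm, Jp)#},
        incumbent := improve n l c (incumbent s) (x, X),
        by_integrality := insert (Jm, Jp) (by_integrality s)\<rparr>)"
| bound:
  "\<lbrakk>selected s (z, Jm, Jp); z < ub n l c (incumbent s);
    optimal_sdp n l c \<epsilon> Jm Jp (x, X); \<not> is_integral n x;
    heuristic_update n l c \<epsilon> (incumbent s) inc';
    z' = ereal (objective n l c 1 X); z' \<ge> ub n l c inc'\<rbrakk> \<Longrightarrow>
   bb_step n l c \<epsilon> s
     (s\<lparr>queue := queue s - {#(z, Jm, Jp)#},
        incumbent := inc',
        by_bound := insert (Jm, Jp) (by_bound s)\<rparr>)"
| branch:
  "\<lbrakk>selected s (z, Jm, Jp); z < ub n l c (incumbent s);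
    optimal_sdp n l c \<epsilon> Jm Jp (x, X); \<not> is_integral n x;
    heuristic_update n l c \<epsilon> (incumbent s) inc';
    z' = ereal (objective n l c 1 X); z' < ub n l c inc';
    p \<in> I2 n - (Jm \<union> Jp); x p \<notin> {- 1, 1}\<rbrakk> \<Longrightarrow>
   bb_step n l c \<epsilon> s
     (s\<lparr>queue := queue s - {#(z, Jm, Jp)#} + {#(z', insert p Jm, Jp), (z', Jm, insert p Jp)#},
        incumbent := inc'\<rparr>)"

text \<open>A completed execution, with final state \<open>s\<close>.\<close>

definition bb_execution :: "nat \<Rightarrow> lengths \<Rightarrow> weights \<Rightarrow> ereal \<Rightarrow> bb_state \<Rightarrow> bool" where
  "bb_execution n l c \<epsilon> s \<longleftrightarrow> (bb_step n l c \<epsilon>)\<^sup>*\<^sup>* bb_init s \<and> queue s = {#}"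

definition pruned_nodes :: "bb_state \<Rightarrow> ((nat \<times> nat) set \<times> (nat \<times> nat) set) set" where
  "pruned_nodes s = by_integrality s \<union> by_bound s"

end

theory Submission
  imports Defs
begin

text \<open>
  The solutions in \<open>feasible n l c \<epsilon>\<close> stay covered by the open and pruned nodes: an infeasible
  node covers none of them, and branching on an index splits them by the sign of an entry.
  Lowering the bound only shrinks the relaxation and does not affect which solutions a node fixes.
\<close>

text \<open>Bounds are dropped because only the fixed indices decide which solutions a node covers.
  Once the queue is empty this is exactly \<open>pruned_nodes s\<close>.\<close>

definition nodes :: "bb_state \<Rightarrow> ((nat \<times> nat) set \<times> (nat \<times> nat) set) set" where
  "nodes s = pruned_nodes s \<union> snd ` set_mset (queue s)"

lemma relaxed_mono: "\<epsilon>' \<le> \<epsilon> \<Longrightarrow> relaxed n l c \<epsilon>' \<subseteq> relaxed n l c \<epsilon>"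
  unfolding relaxed_def by (auto intro: order_trans)

lemma feasible_mono: "\<epsilon>' \<le> \<epsilon> \<Longrightarrow> feasible n l c \<epsilon>' \<subseteq> feasible n l c \<epsilon>"
  using relaxed_mono[of \<epsilon>' \<epsilon> n l c] unfolding feasible_def by auto

text \<open>Integrality leaves only -1 and 1 for \<open>x p\<close>, and each value meets the extra
  constraint of one child.\<close>

lemma feasible_sdp_branch:
  assumes "(x, X) \<in> feasible_sdp n l c \<epsilon> Jm Jp" "is_integral n x" "p \<in> I2 n"
  shows "(x, X) \<in> feasible_sdp n l c \<epsilon> (insert p Jm) Jp \<union> feasible_sdp n l c \<epsilon> Jm (insert p Jp)"
  using assms unfolding feasible_sdp_def is_integral_def by auto

text \<open>Several queue entries may share a pair, so deleting one entry can lose at most the pair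
  of that entry.\<close>

lemma snd_in_queue_remove:
  assumes "(Jm, Jp) \<in> snd ` set_mset Q"
  shows "(Jm, Jp) = snd \<nu> \<or> (Jm, Jp) \<in> snd ` set_mset (Q - {#\<nu>#})"
proof -
  from assms obtain \<mu> where "\<mu> \<in># Q" "(Jm, Jp) = snd \<mu>" by auto
  then show ?thesis by (cases "\<mu> = \<nu>") (auto simp: in_diff_count)
qed

lemma bb_step_nodes:
  assumes "bb_step n l c \<epsilon> s s'" "(Jm, Jp) \<in> nodes s"
    and sol: "(x, X) \<in> feasible_sdp n l c \<epsilon> Jm Jp" "is_integral n x"
  shows "\<exists>(Jm', Jp') \<in> nodes s'. (x, X) \<in> feasible_sdp n l c \<epsilon> Jm' Jp'"
  using assms(1)
proof cases
  case stop
  \<comment> \<open>The whole queue moves into \<open>by_bound\<close>, so \<open>nodes\<close> is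
    unchanged.\<close>
  then show ?thesis using assms(2) sol
    by (force simp: nodes_def pruned_nodes_def)
next
  case (infeasible z Km Kp)
  \<comment> \<open>The only pair that can disappear has an empty feasible region, so by
    \<open>sol\<close> it is not \<open>(Jm, Jp)\<close>.\<close>
  then show ?thesis using assms(2) sol snd_in_queue_remove[of Jm Jp "queue s" "(z, Km, Kp)"]
    by (auto simp: nodes_def pruned_nodes_def)
next
  case (integrality z Km Kp)
  then show ?thesis using assms(2) sol snd_in_queue_remove[of Jm Jp "queue s" "(z, Km, Kp)"]
    by (auto simp: nodes_def pruned_nodes_def)
next
  case (bound z Km Kp)
  then show ?thesis using assms(2) sol snd_in_queue_remove[of Jm Jp "queue s" "(z, Km, Kp)"]
    by (auto simp: nodes_def pruned_nodes_def)
next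
  case (branch z Km Kp y Y inc' z' p)
  have new: "(insert p Km, Kp) \<in> nodes s'" "(Km, insert p Kp) \<in> nodes s'"
    using branch(1) by (auto simp: nodes_def)
  \<comment> \<open>Only the branched node can be lost; its two children take over.\<close>
  have "(Jm, Jp) = (Km, Kp) \<or> (Jm, Jp) \<in> nodes s'"
    using branch(1) assms(2) snd_in_queue_remove[of Jm Jp "queue s" "(z, Km, Kp)"]
    by (auto simp: nodes_def pruned_nodes_def)
  then show ?thesis
  proof
    assume "(Jm, Jp) = (Km, Kp)"
    then show ?thesis using feasible_sdp_branch[of x X n l c \<epsilon> Km Kp p] sol branch new by auto
  next
    assume "(Jm, Jp) \<in> nodes s'"
    then show ?thesis using sol by blast
  qed
qed

lemma bb_reachable_covers:
  assumes "(bb_step n l c \<epsilon>)\<^sup>*\<^sup>* bb_init s" "(x, X) \<in> feasible n l c \<epsilon>"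
  shows "\<exists>(Jm, Jp) \<in> nodes s. (x, X) \<in> feasible_sdp n l c \<epsilon> Jm Jp"
  using assms(1)
proof induction
  case base
  \<comment> \<open>The root node fixes no index.\<close>
  show ?case using assms(2)
    by (auto simp: nodes_def bb_init_def feasible_def feasible_sdp_def)
next
  case (step s s')
  have "is_integral n x" using assms(2) by (simp add: feasible_def)
  then show ?case using step.IH bb_step_nodes[OF step.hyps(2)] by blast
qed

theorem theorem7:
  fixes n :: nat and l :: "nat \<Rightarrow> real" and c :: "nat \<Rightarrow> nat \<Rightarrow> nat \<Rightarrow> real"
    and \<epsilon> :: ereal and s :: bb_state
  assumes "\<And>i. i \<in> {1..n} \<Longrightarrow> l i > 0"
    and "\<And>q i j. q \<in> {1, 2} \<Longrightarrow> i \<in> {1..n} \<Longrightarrow> j \<in> {1..n} \<Longrightarrow> c q i j \<ge> 0"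
    and "\<And>q i j. q \<in> {1, 2} \<Longrightarrow> i \<in> {1..n} \<Longrightarrow> j \<in> {1..n} \<Longrightarrow> c q i j = c q j i"
    and "\<epsilon> \<noteq> - \<infinity>"
    and "bb_execution n l c \<epsilon> s"
  shows "\<forall>\<epsilon>'. \<epsilon>' \<noteq> - \<infinity> \<and> \<epsilon>' \<le> \<epsilon> \<longrightarrow>
    feasible n l c \<epsilon>' \<subseteq> (\<Union>(Jm, Jp)\<in>pruned_nodes s. feasible_sdp n l c \<epsilon>' Jm Jp)"
proof (intro allI impI subsetI)
  fix \<epsilon>' sol
  assume e: "\<epsilon>' \<noteq> - \<infinity> \<and> \<epsilon>' \<le> \<epsilon>" and sol: "sol \<in> feasible n l c \<epsilon>'"
  obtain x X where xX: "sol = (x, X)" by (cases sol)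
  \<comment> \<open>The execution ran with \<open>\<epsilon>\<close>, so the covering node has to be
    found for that bound.\<close>
  have "(x, X) \<in> feasible n l c \<epsilon>" using feasible_mono[of \<epsilon>' \<epsilon> n l c] e sol xX by blast
  moreover have "(bb_step n l c \<epsilon>)\<^sup>*\<^sup>* bb_init s" "nodes s = pruned_nodes s"
    using assms(5) by (auto simp: bb_execution_def nodes_def)
  ultimately obtain Jm Jp where "(Jm, Jp) \<in> pruned_nodes s" "(x, X) \<in> feasible_sdp n l c \<epsilon> Jm Jp"
    using bb_reachable_covers[of n l c \<epsilon> s x X] by auto
  \<comment> \<open>The node contributes only the fixed entries of \<open>x\<close>; membership in
    the relaxation for \<open>\<epsilon>'\<close> comes from \<open>sol\<close> itself.\<close>
  moreover from this(2) have "(x, X) \<in> feasible_sdp n l c \<epsilon>' Jm Jp"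
    using sol xX by (auto simp: feasible_def feasible_sdp_def)
  ultimately show "sol \<in> (\<Union>(Jm, Jp)\<in>pruned_nodes s. feasible_sdp n l c \<epsilon>' Jm Jp)"
    using xX by blast
qed

end
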